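(* In the setting of the context (Assumptions (1)-(4), step sizes such that every $\hat T^{t_m}$ is a contraction with modulus $\Delta<1$, model-error vector $\rho$, and drift constant $\sigma$), let $K\ge1$ and let $\{y^{t_m}(K)\}_m$ be the sequence generated by the online algorithm $y^{t_m}(0)=y^{t_{m-1}}(K)$, $y^{t_m}(k+1)=T^{t_m}(y^{t_m}(k))$ for $k=0,\dots,K-1$. Then $$\limsup_{m\to\infty}\|y^{t_m}(K)-\hat y^{t_m*}\|\ \le\ \frac{\|\rho\|}{1-\Delta}+\frac{\sigma\Delta^K}{1-\Delta^K}.$$
   Context: Let $\mathcal N=\{1,\dots,N\}$ and $t_m$, $m\in\mathbb N$, be discrete times. At each $t=t_m$ there are cost functions $C_i^{t}(z_i)$, $z_i=(p_i,q_i)$, $D^{t}:\mathbb R^N\to\mathbb R$, a weight $\gamma^{t}\ge0$, voltage limits $\underline v^{t},\overline v^{t}\in\mathbb R^N$, nonempty convex compact sets $\mathcal Z_i^{t}\subset\mathbb R^2$, $\mathcal Z^{t}=\prod_i\mathcal Z_i^{t}$, and a linearized power-flow model $\hat v^{t}(z)=Rp+Xq+a$ with $R,X\in\mathbb R^{N\times N}$ positive, symmetric matrices (rows $R_i^\top$, $X_i^\top$), $z=(p,q)\in\mathbb R^{2N}$. The true voltage magnitudes $v^{t}(z)\in\mathbb R^N$ are those determined by the injections $z$ through the nonlinear AC power-flow equations on the distribution tree with node set $\mathcal N\cup\{0\}$ and line set $\mathcal E$: for each line $(i,j)\in\mathcal E$ with impedance $r_{ij}+\mathrm{j}x_{ij}$,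 $P_{ij}=-p_j+\sum_{k:(j,k)\in\mathcal E}P_{jk}+r_{ij}\ell_{ij}$, $Q_{ij}=-q_j+\sum_{k:(j,k)\in\mathcal E}Q_{jk}+x_{ij}\ell_{ij}$, $v_j^2=v_i^2-2(r_{ij}P_{ij}+x_{ij}Q_{ij})+(r_{ij}^2+x_{ij}^2)\ell_{ij}$, $\ell_{ij}v_i^2=P_{ij}^2+Q_{ij}^2$. Assumptions (at every time). (1) Each $C_i^t$ is continuously differentiable, strongly convex, with first-order derivative bounded on $\mathcal Z_i^t$. (2) $D^t$ is continuously differentiable and convex, with first-order derivative bounded at achievable voltage magnitudes. (3) There is $(\tilde p,\tilde q)\in\mathcal Z^t$ with $\underline v^t\le R\tilde p+X\tilde q+a\le\overline v^t$. (4) There is a constant $e>0$ with $|v_i^{t_m}(z)-\hat v_i^{t_m}(z)|\le e$ for all $i\in\mathcal N$, $z\in\mathcal Z^{t_m}$ and all $m$. Regularized Lagrangian: for a fixed $\phi>0$, $\mu=(\underline\mu,\overline\mu)\in\mathbb R_+^{2N}$, $$\mathcal L_\phi^t(z,\mu)=\sum_iC_i^t(z_i)+\gamma^tD^t(Rp+Xq+a)+\underline\mu^\top(\underline v^t-Rp-Xq-a)+\overline\mu^\top(Rp+Xq+a-\overline v^t)-\tfrac\phi2\|\mu\|^2 .$$ Write $y=(z,\mu)$; $\hat y^{t_m*}$ is the unique solution of $\max_{\mu\in\mathbb R_+^{2N}}\min_{z\in\mathcal Z^{t_m}}\mathcal L_\phi^{t_m}(z,\mu)$. With step sizes $\varepsilon_1,\varepsilon_2>0$,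 define $$\hat T^{t}(z,\mu)=\Big[(z,\mu)-\big(\varepsilon_1\nabla_z\mathcal L_\phi^t(z,\mu),\,-\varepsilon_2\nabla_\mu\mathcal L^t_\phi(z,\mu)\big)\Big]_{\mathcal Z^t\times\mathbb R_+^{2N}}$$ where $[\cdot]_S$ is Euclidean projection onto $S$. The map $T^t$ is the counterpart of $\hat T^t$ in which the linearized voltages are replaced by measured voltages $v^t=v^t(z)$: $T^t(z,\mu)$ has components $\big[z_i-\varepsilon_1(\nabla_{z_i}C_i^t(z_i)-s_i)\big]_{\mathcal Z_i^t}$ with $s_i=(\alpha_i,\beta_i)$, $\alpha=R(\underline\mu-\overline\mu-\gamma^t\nabla D^t(v^t))$, $\beta=X(\underline\mu-\overline\mu-\gamma^t\nabla D^t(v^t))$, and dual components $[\underline\mu+\varepsilon_2(\underline v^t-v^t-\phi\underline\mu)]_+$, $[\overline\mu+\varepsilon_2(v^t-\overline v^t-\phi\overline\mu)]_+$. Constants. The step sizes are chosen small enough that each $\hat T^{t_m}$ is a contraction, with common modulus $\Delta<1$: $\|\hat T^{t_m}(y)-\hat T^{t_m}(y')\|\le\Delta\|y-y'\|$ for all $y,y'\in\mathcal Z^{t_m}\times\mathbb R_+^{2N}$. The vector $\rho\in\mathbb R_+^{4N}$ is $\rho=[\varepsilon_2e\,\mathbf 1_{1\times2N},\delta^\top]^\top$ with $\delta=[\delta_{1,1},\dots,\delta_{1,N},\delta_{2,1},\dots,\delta_{2,N}]^\top$, $\delta_{1,i}=\varepsilon_1R_i^\top(\gamma\nabla_v^2D(\tilde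 v)\mathbf 1+\varepsilon_2\mathbf 1)e$, $\delta_{2,i}=\varepsilon_1X_i^\top(\gamma\nabla_v^2D(\tilde v)\mathbf 1+\varepsilon_2\mathbf 1)e$ for some intermediate voltage vector $\tilde v$, and it satisfies $\|\hat T^{t_m}(y)-T^{t_m}(y)\|\le\|\rho\|$ for all $y\in\mathcal Z^{t_m}\times\mathbb R_+^{2N}$ and all $m$. The constant $0<\sigma<\infty$ satisfies $\|\hat y^{t_{m+1}*}-\hat y^{t_m*}\|\le\sigma$ for all $m$.
   Formalization: Added assumption: whenever the start y^{t_m}(0) lies outside Z^{t_m}×R_+^{2N} (possible as Z^{t_m} varies), the contraction bound and the model-error bound ‖ρ‖ are assumed to hold at that point too; without this the claim can fail. *)

theory Defs
  imports "HOL-Analysis.Analysis"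
begin

section \<open>Gradients, strong convexity\<close>

definition gradient :: "('a::real_inner \<Rightarrow> real) \<Rightarrow> 'a \<Rightarrow> 'a" where
  "gradient f x = (THE d. GDERIV f x :> d)"

text \<open>Full (two-sided) derivatives are required at the points of \<open>S\<close>, so that \<^const>\<open>gradient\<close>
  is determined there even if \<open>S\<close> has empty interior.\<close>

definition C1_on :: "'a::euclidean_space set \<Rightarrow> ('a \<Rightarrow> real) \<Rightarrow> bool" where
  "C1_on S f \<longleftrightarrow> (\<forall>x\<in>S. f differentiable (at x)) \<and> continuous_on S (gradient f)"

definition strongly_convex_on :: "'a::real_normed_vector set \<Rightarrow> ('a \<Rightarrow> real) \<Rightarrow> bool" where
  "strongly_convex_on S f \<longleftrightarrow> (\<exists>c>0. \<forall>x\<in>S. \<forall>y\<in>S. \<forall>u\<in>{0..1}.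
     f ((1 - u) *\<^sub>R x + u *\<^sub>R y)
       \<le> (1 - u) * f x + u * f y - c / 2 * u * (1 - u) * (norm (x - y))\<^sup>2)"


section \<open>Power flow on a distribution tree\<close>

text \<open>Node \<open>0\<close> (the substation) is \<^const>\<open>None\<close>, the other nodes are \<open>Some i\<close>.
  Lines are directed away from node \<open>0\<close>.\<close>

definition distribution_tree :: "('n option \<times> 'n option) set \<Rightarrow> bool" where
  "distribution_tree E \<longleftrightarrow>
     (\<forall>i. (i, None) \<notin> E) \<and> (\<forall>j. \<exists>!i. (i, Some j) \<in> E) \<and> (\<forall>j. (None, j) \<in> E\<^sup>*)"

text \<open>\<open>v\<close> is a vector of voltage magnitudes solving the branch flow equations for the
  injections \<open>(p, q)\<close>; \<open>v0\<close> is the voltage magnitude at the substation, and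
  \<open>l\<close> is the vector of squared current magnitudes.  The equations may have several
  solutions, so this is a relation.\<close>

definition power_flow ::
  "('n::finite option \<times> 'n option) set \<Rightarrow> ('n option \<times> 'n option \<Rightarrow> real) \<Rightarrow>
   ('n option \<times> 'n option \<Rightarrow> real) \<Rightarrow> real \<Rightarrow> (real^'n) \<times> (real^'n) \<Rightarrow> real^'n \<Rightarrow> bool" where
  "power_flow E r x v0 z v \<longleftrightarrow> (\<exists>P Q l. \<exists>w :: 'n option \<Rightarrow> real.
     w None = v0 \<and> (\<forall>i. w (Some i) = v $ i) \<and> (\<forall>i. 0 \<le> w i) \<and> (\<forall>e\<in>E. 0 \<le> l e) \<and>
     (\<forall>i j. (i, Some j) \<in> E \<longrightarrow>
        P (i, Some j) = - fst z $ j + (\<Sum>k | (Some j, k) \<in> E. P (Some j, k))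
                          + r (i, Some j) * l (i, Some j) \<and>
        Q (i, Some j) = - snd z $ j + (\<Sum>k | (Some j, k) \<in> E. Q (Some j, k))
                          + x (i, Some j) * l (i, Some j) \<and>
        (w (Some j))\<^sup>2 = (w i)\<^sup>2
            - 2 * (r (i, Some j) * P (i, Some j) + x (i, Some j) * Q (i, Some j))
            + ((r (i, Some j))\<^sup>2 + (x (i, Some j))\<^sup>2) * l (i, Some j) \<and>
        l (i, Some j) * (w i)\<^sup>2 = (P (i, Some j))\<^sup>2 + (Q (i, Some j))\<^sup>2))"


section \<open>The voltage control problem at one time instant\<close>

text \<open>\<open>cost\<close>, \<open>vcost\<close>, \<open>weight\<close> are \<open>C\<^sub>i\<close>, \<open>D\<close>, \<open>\<gamma>\<close>; \<open>zset i\<close> is the set of admissible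
  \<open>(p\<^sub>i, q\<^sub>i)\<close>; \<open>slack\<close> is the substation voltage magnitude and \<open>volt z\<close> the true
  voltage magnitudes at injections \<open>z\<close>.\<close>

record ('n::finite) snapshot =
  cost :: "'n \<Rightarrow> real \<times> real \<Rightarrow> real"
  vcost :: "real^'n \<Rightarrow> real"
  weight :: real
  vlow :: "real^'n"
  vhigh :: "real^'n"
  zset :: "'n \<Rightarrow> (real \<times> real) set"
  slack :: real
  volt :: "(real^'n) \<times> (real^'n) \<Rightarrow> real^'n"

text \<open>Injections \<open>z = (p, q)\<close>, multipliers \<open>\<mu> = (\<mu>\<^sub>l, \<mu>\<^sub>h)\<close> for the lower and upper
  voltage limits, and pairs \<open>y = (z, \<mu>)\<close>.
  The norm on products is the Euclidean one.\<close>

type_synonym 'n injection = "(real^'n) \<times> (real^'n)"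
type_synonym 'n multiplier = "(real^'n) \<times> (real^'n)"
type_synonym 'n state = "'n injection \<times> 'n multiplier"

definition feasible :: "'n::finite snapshot \<Rightarrow> 'n injection set" where
  "feasible S = {z. \<forall>i. (fst z $ i, snd z $ i) \<in> zset S i}"

definition nonneg_multipliers :: "'n::finite multiplier set" where
  "nonneg_multipliers = {\<mu>. 0 \<le> fst \<mu> \<and> 0 \<le> snd \<mu>}"

definition domain :: "'n::finite snapshot \<Rightarrow> 'n state set" where
  "domain S = feasible S \<times> nonneg_multipliers"

definition lin_volt :: "real^'n^'n \<Rightarrow> real^'n^'n \<Rightarrow> real^'n \<Rightarrow> 'n::finite injection \<Rightarrow> real^'n" where
  "lin_volt R X a z = R *v fst z + X *v snd z + a"

definition lagrangian ::
  "real^'n^'n \<Rightarrow> real^'n^'n \<Rightarrow> real^'n \<Rightarrow> real \<Rightarrow> 'n::finite snapshot \<Rightarrow>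
   'n injection \<Rightarrow> 'n multiplier \<Rightarrow> real" where
  "lagrangian R X a \<phi> S z \<mu> =
     (\<Sum>i\<in>UNIV. cost S i (fst z $ i, snd z $ i))
     + weight S * vcost S (lin_volt R X a z)
     + fst \<mu> \<bullet> (vlow S - lin_volt R X a z)
     + snd \<mu> \<bullet> (lin_volt R X a z - vhigh S)
     - \<phi> / 2 * (norm \<mu>)\<^sup>2"

definition maxmin_solution ::
  "real^'n^'n \<Rightarrow> real^'n^'n \<Rightarrow> real^'n \<Rightarrow> real \<Rightarrow> 'n::finite snapshot \<Rightarrow> 'n state \<Rightarrow> bool" where
  "maxmin_solution R X a \<phi> S y \<longleftrightarrow>
     is_arg_max (\<lambda>\<mu>. INF z\<in>feasible S. lagrangian R X a \<phi> S z \<mu>)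
       (\<lambda>\<mu>. \<mu> \<in> nonneg_multipliers) (snd y) \<and>
     is_arg_min (\<lambda>z. lagrangian R X a \<phi> S z (snd y)) (\<lambda>z. z \<in> feasible S) (fst y)"

definition T_hat ::
  "real^'n^'n \<Rightarrow> real^'n^'n \<Rightarrow> real^'n \<Rightarrow> real \<Rightarrow> real \<Rightarrow> real \<Rightarrow> 'n::finite snapshot \<Rightarrow>
   'n state \<Rightarrow> 'n state" where
  "T_hat R X a \<phi> \<epsilon>1 \<epsilon>2 S y =
     closest_point (domain S)
       (y - (\<epsilon>1 *\<^sub>R gradient (\<lambda>z. lagrangian R X a \<phi> S z (snd y)) (fst y),
             - (\<epsilon>2 *\<^sub>R gradient (\<lambda>\<mu>. lagrangian R X a \<phi> S (fst y) \<mu>) (snd y))))"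

definition pos_part :: "real^'n \<Rightarrow> real^'n::finite" where
  "pos_part u = (\<chi> i. max 0 (u $ i))"

definition T_meas ::
  "real^'n^'n \<Rightarrow> real^'n^'n \<Rightarrow> real \<Rightarrow> real \<Rightarrow> real \<Rightarrow> 'n::finite snapshot \<Rightarrow>
   'n state \<Rightarrow> 'n state" where
  "T_meas R X \<phi> \<epsilon>1 \<epsilon>2 S y =
     (let p = fst (fst y); q = snd (fst y); \<mu>l = fst (snd y); \<mu>h = snd (snd y);
          v = volt S (fst y);
          g = \<mu>l - \<mu>h - weight S *\<^sub>R gradient (vcost S) v;
          \<alpha> = R *v g; \<beta> = X *v g;
          z' = (\<lambda>i. closest_point (zset S i)
                  ((p $ i, q $ i)
                   - \<epsilon>1 *\<^sub>R (gradient (cost S i) (p $ i, q $ i) - (\<alpha> $ i, \<beta> $ i))))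
      in ((\<chi> i. fst (z' i), \<chi> i. snd (z' i)),
          (pos_part (\<mu>l + \<epsilon>2 *\<^sub>R (vlow S - v - \<phi> *\<^sub>R \<mu>l)),
           pos_part (\<mu>h + \<epsilon>2 *\<^sub>R (v - vhigh S - \<phi> *\<^sub>R \<mu>h)))))"

text \<open>The vector \<open>\<rho> = [\<epsilon>\<^sub>2 e 1, \<delta>\<^sub>1, \<delta>\<^sub>2]\<close>, where \<open>H\<close> stands for the Hessian of \<open>D\<close>
  and \<open>1 :: real^'n\<close> is the all-ones vector.\<close>

definition model_error ::
  "real^'n^'n \<Rightarrow> real^'n^'n \<Rightarrow> real \<Rightarrow> real \<Rightarrow> real \<Rightarrow> real \<Rightarrow> real^'n^'n \<Rightarrow>
   ((real^'n) \<times> (real^'n)) \<times> ((real^'n) \<times> (real^'n::finite))" where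
  "model_error R X \<epsilon>1 \<epsilon>2 e \<gamma> H =
     (let u = \<gamma> *\<^sub>R (H *v 1) + \<epsilon>2 *\<^sub>R 1
      in (((\<epsilon>2 * e) *\<^sub>R 1, (\<epsilon>2 * e) *\<^sub>R 1),
          (\<chi> i. \<epsilon>1 * (row i R \<bullet> u) * e, \<chi> i. \<epsilon>1 * (row i X \<bullet> u) * e)))"

definition online_iterates ::
  "real^'n^'n \<Rightarrow> real^'n^'n \<Rightarrow> real \<Rightarrow> real \<Rightarrow> real \<Rightarrow> (nat \<Rightarrow> 'n::finite snapshot) \<Rightarrow>
   nat \<Rightarrow> (nat \<Rightarrow> nat \<Rightarrow> 'n state) \<Rightarrow> bool" where
  "online_iterates R X \<phi> \<epsilon>1 \<epsilon>2 S K y \<longleftrightarrow>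
     (\<forall>m. y (Suc m) 0 = y m K) \<and>
     (\<forall>m. \<forall>k<K. y m (Suc k) = T_meas R X \<phi> \<epsilon>1 \<epsilon>2 (S m) (y m k))"

end

theory Submission
  imports Defs
begin

text \<open>
  Within one time instant the online algorithm iterates a perturbation of a contraction.  Writing
  \<open>d\<^sub>k\<close> for the distance of the \<open>k\<close>-th iterate from the saddle point \<open>\<hat>y\<close> of that instant, the
  model gap and the contraction property give \<open>d\<^sub>k\<^sub>+\<^sub>1 \<le> \<Delta> d\<^sub>k + \<parallel>\<rho>\<parallel>\<close>, provided that \<open>\<hat>y\<close> is a
  fixed point of the model map.  Summing the geometric series over \<open>K\<close> steps
  (\<open>perturbed_contraction_iterates\<close>) and adding the drift \<open>\<sigma>\<close> between instants, the error at the
  end of each instant obeys an affine recursion with factor \<open>\<Delta>\<^sup>K < 1\<close>, whose fixed point is the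
  asserted bound (\<open>limsup_affine_recursion\<close>).

  The substantial part is that a max-min solution \<open>(x, \<nu>)\<close> of the regularised Lagrangian is a fixed
  point of the projected gradient step (\<open>maxmin_solution_fixed_point\<close>).  Projection turns this into
  two variational inequalities.  The one in the injections is the first-order condition for the
  minimiser \<open>x\<close> of the Lagrangian at \<open>\<nu>\<close>.  The one in the multipliers says that the gradient of the
  dual function at its maximiser \<open>\<nu>\<close> is the constraint gap at \<open>x\<close> minus \<open>\<phi> \<nu>\<close>, as in Danskin's
  theorem.  Instead of differentiating the dual function, \<open>dual_maximizer_variational_inequality\<close>
  bounds it below by a quadratic along segments: strong convexity makes the Lagrangian grow
  quadratically away from \<open>x\<close>, so moving the multiplier by \<open>t\<close> can lower the minimum by only
  \<open>O(t\<^sup>2)\<close> relative to the value at \<open>x\<close>.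

  Finally, the hypotheses on the two maps speak of points of the domain.  Every iterate after the
  first of an instant lies there because the measured map projects onto it; the first one is
  inherited from the previous instant and, if it lies outside, is covered by the handover hypothesis.
\<close>

section \<open>Convex optimisation\<close>

lemma gradient_eqI:
  assumes "GDERIV f x :> d"
  shows "gradient f x = d"
  unfolding gradient_def
proof (rule the_equality)
  show "GDERIV f x :> d" by (fact assms)
next
  fix d' assume "GDERIV f x :> d'"
  then have "(\<lambda>h. h \<bullet> d') = (\<lambda>h. h \<bullet> d)"
    using assms unfolding gderiv_def by (rule has_derivative_unique)
  then show "d' = d"
    by (metis vector_eq_ldot)
qed

text \<open>In a Euclidean space the derivative, a linear functional, is represented by a vector, namely the
  value of its adjoint at \<open>1\<close>.\<close>
lemma differentiable_imp_gderiv_gradient: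
  fixes f :: "'a::euclidean_space \<Rightarrow> real"
  assumes "f differentiable (at x)"
  shows "GDERIV f x :> gradient f x"
proof -
  obtain f' where f': "(f has_derivative f') (at x)"
    using assms unfolding differentiable_def by blast
  then have "linear f'" by (rule has_derivative_linear)
  then have "f' = (\<lambda>h. h \<bullet> adjoint f' 1)"
    using adjoint_works[of f' _ 1] by auto
  with f' have "GDERIV f x :> adjoint f' 1"
    unfolding gderiv_def by simp
  then show ?thesis using gradient_eqI by metis
qed

text \<open>A negative slope along the segment from \<open>x\<close> to \<open>z\<close>, which stays in \<open>Z\<close>, would give points of
  \<open>Z\<close> with a smaller value.\<close>
lemma minimizer_variational_inequality:
  assumes "convex Z" "x \<in> Z" "z \<in> Z" and min: "\<And>w. w \<in> Z \<Longrightarrow> f x \<le> f w"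
    and G: "GDERIV f x :> g"
  shows "0 \<le> (z - x) \<bullet> g"
proof (rule ccontr)
  assume neg: "\<not> ?thesis"
  have "((\<lambda>t. x + t *\<^sub>R (z - x)) has_derivative (\<lambda>t. t *\<^sub>R (z - x))) (at 0)"
    by (auto intro!: derivative_eq_intros)
  moreover have "(f has_derivative (\<lambda>h. h \<bullet> g)) (at (x + 0 *\<^sub>R (z - x)))"
    using G unfolding gderiv_def by simp
  ultimately have "((\<lambda>t. f (x + t *\<^sub>R (z - x))) has_derivative (\<lambda>t. (t *\<^sub>R (z - x)) \<bullet> g)) (at 0)"
    by (rule has_derivative_compose)
  then have "((\<lambda>t. f (x + t *\<^sub>R (z - x))) has_real_derivative (z - x) \<bullet> g) (at 0)"
    by (simp add: has_field_derivative_def mult.commute[of _ "(z - x) \<bullet> g"])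
  then obtain d where "d > 0" and d: "\<And>h. 0 < h \<Longrightarrow> h < d \<Longrightarrow> f (x + h *\<^sub>R (z - x)) < f x"
    using DERIV_neg_dec_right[of "\<lambda>t. f (x + t *\<^sub>R (z - x))" "(z - x) \<bullet> g" 0] neg by force
  define h where "h = min (d / 2) 1"
  have h: "0 < h" "h < d" "h \<le> 1" using \<open>d > 0\<close> by (auto simp: h_def min_def)
  have "x + h *\<^sub>R (z - x) \<in> Z"
    using convexD_alt[OF assms(1-3), of h] h by (simp add: algebra_simps)
  then show False using min d[OF h(1,2)] by force
qed

text \<open>Under the inequality the angle at \<open>x\<close> between \<open>w\<close> and any \<open>y \<in> A\<close> is not acute, so
  \<open>x\<close> is at least as close to \<open>w\<close> as \<open>y\<close> is.  This is the converse of
  \<open>closest_point_dot\<close>.\<close>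
lemma closest_point_eqI_variational:
  fixes x w :: "'a::euclidean_space"
  assumes "convex A" "closed A" "x \<in> A" and vi: "\<And>y. y \<in> A \<Longrightarrow> (y - x) \<bullet> (w - x) \<le> 0"
  shows "closest_point A w = x"
proof -
  have "dist w x \<le> dist w y" if "y \<in> A" for y
  proof -
    have "(norm (w - y))\<^sup>2 = (norm (w - x))\<^sup>2 + (norm (y - x))\<^sup>2 - 2 * ((y - x) \<bullet> (w - x))"
      unfolding power2_norm_eq_inner by (simp add: algebra_simps inner_commute)
    then have "(norm (w - x))\<^sup>2 \<le> (norm (w - y))\<^sup>2"
      using vi[OF that] zero_le_power2[of "norm (y - x)"] by linarith
    then show ?thesis by (simp add: dist_norm)
  qed
  then show ?thesis using closest_point_unique[OF assms(1-3), of w] by metis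
qed

text \<open>Compare the minimiser \<open>x\<close> with the midpoint of \<open>x\<close> and \<open>z\<close>.  Half of the optimal constant is
  lost in this way; only its positivity matters below.\<close>
lemma strongly_convex_on_quadratic_growth:
  assumes "strongly_convex_on Z f" "convex Z"
  obtains \<kappa> where "0 < \<kappa>"
    "\<And>x z. x \<in> Z \<Longrightarrow> z \<in> Z \<Longrightarrow> (\<And>w. w \<in> Z \<Longrightarrow> f x \<le> f w) \<Longrightarrow> f x + \<kappa> * (norm (z - x))\<^sup>2 \<le> f z"
proof -
  obtain c where "c > 0" and c: "\<And>x y u. x \<in> Z \<Longrightarrow> y \<in> Z \<Longrightarrow> u \<in> {0..1} \<Longrightarrow>
     f ((1 - u) *\<^sub>R x + u *\<^sub>R y) \<le> (1 - u) * f x + u * f y - c / 2 * u * (1 - u) * (norm (x - y))\<^sup>2"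
    using assms(1) unfolding strongly_convex_on_def by metis
  show ?thesis
  proof (rule that[of "c / 4"])
    fix x z assume xz: "x \<in> Z" "z \<in> Z" and min: "\<And>w. w \<in> Z \<Longrightarrow> f x \<le> f w"
    have "f x \<le> f ((1 - 1/2) *\<^sub>R x + (1/2) *\<^sub>R z)"
      using convexD_alt[OF assms(2) xz, of "1/2"] by (intro min) auto
    also have "\<dots> \<le> (1 - 1/2) * f x + 1/2 * f z - c / 2 * (1/2) * (1 - 1/2) * (norm (x - z))\<^sup>2"
      using xz by (intro c) auto
    finally show "f x + c / 4 * (norm (z - x))\<^sup>2 \<le> f z"
      by (simp add: norm_minus_commute)
  qed (use \<open>c > 0\<close> in simp)
qed

text \<open>The half of Danskin's theorem needed for the optimality condition of the dual problem, in which
  \<open>c x - \<phi> \<nu>\<close> is the gradient of the dual function at \<open>\<nu>\<close>.  With \<open>\<mu>\<close> at distance \<open>t\<close> along the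
  segment from \<open>\<nu>\<close>, the Lagrangian at \<open>z\<close> exceeds its value at \<open>(x, \<nu>)\<close> by at least
  \<open>t\<close> times the asserted inner product, plus the growth \<open>\<kappa> s\<^sup>2\<close> with \<open>s = \<parallel>z - x\<parallel>\<close>, minus
  \<open>O(t s) + O(t\<^sup>2)\<close>.  Completing the square absorbs \<open>O(t s)\<close> into the growth term, uniformly in \<open>z\<close>.
  Hence the dual value changes by at least \<open>t\<close> times the inner product minus \<open>t\<^sup>2 B\<close>; it cannot
  increase, and \<open>t \<rightarrow> 0\<close> gives the claim.\<close>
lemma dual_maximizer_variational_inequality:
  fixes F :: "'a::real_inner \<Rightarrow> real" and c :: "'a \<Rightarrow> 'b::real_inner" and \<phi> :: real
  defines "L \<equiv> \<lambda>z \<mu>. F z + \<mu> \<bullet> c z - \<phi> / 2 * (norm \<mu>)\<^sup>2"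
  assumes "convex N" "x \<in> Z" "\<nu> \<in> N" "\<mu> \<in> N" "0 < \<kappa>"
    and growth: "\<And>z. z \<in> Z \<Longrightarrow> L x \<nu> + \<kappa> * (norm (z - x))\<^sup>2 \<le> L z \<nu>"
    and lip: "\<And>z. z \<in> Z \<Longrightarrow> norm (c z - c x) \<le> M * norm (z - x)"
    and max: "\<And>\<mu>. \<mu> \<in> N \<Longrightarrow> (INF z\<in>Z. L z \<mu>) \<le> (INF z\<in>Z. L z \<nu>)"
  shows "(\<mu> - \<nu>) \<bullet> (c x - \<phi> *\<^sub>R \<nu>) \<le> 0"
proof -
  define d where "d = \<mu> - \<nu>"
  define B where "B = (norm d * M)\<^sup>2 / (4 * \<kappa>) + \<phi> / 2 * (norm d)\<^sup>2"
  have Linf: "(INF z\<in>Z. L z \<nu>) = L x \<nu>"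
  proof (rule cInf_eq_minimum)
    fix l assume "l \<in> (\<lambda>z. L z \<nu>) ` Z"
    then obtain z where z: "z \<in> Z" "l = L z \<nu>" by auto
    have "0 \<le> \<kappa> * (norm (z - x))\<^sup>2" using \<open>0 < \<kappa>\<close> by simp
    then show "L x \<nu> \<le> l" using growth[OF z(1)] z(2) by linarith
  qed (use \<open>x \<in> Z\<close> in blast)
  have bound: "d \<bullet> (c x - \<phi> *\<^sub>R \<nu>) \<le> t * B" if t: "0 < t" "t \<le> 1" for t
  proof -
    let ?m = "\<nu> + t *\<^sub>R d"
    have mN: "?m \<in> N"
      using convexD_alt[OF \<open>convex N\<close> \<open>\<nu> \<in> N\<close> \<open>\<mu> \<in> N\<close>, of t] t by (simp add: d_def algebra_simps)
    have shift: "L z ?m = L z \<nu> + t * (d \<bullet> (c z - \<phi> *\<^sub>R \<nu>)) - t\<^sup>2 * (\<phi> / 2 * (norm d)\<^sup>2)" for z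
      unfolding L_def power2_norm_eq_inner
      by (simp add: algebra_simps inner_commute power2_eq_square)
    have "L x \<nu> + t * (d \<bullet> (c x - \<phi> *\<^sub>R \<nu>)) - t\<^sup>2 * B \<le> (INF z\<in>Z. L z ?m)"
    proof (rule cINF_greatest)
      fix z assume z: "z \<in> Z"
      let ?s = "norm (z - x)" and ?b = "norm d * M"
      have "- (d \<bullet> (c z - c x)) \<le> norm d * norm (c z - c x)"
        using Cauchy_Schwarz_ineq2[of d "c z - c x"] by linarith
      also have "\<dots> \<le> ?b * ?s"
        using mult_left_mono[OF lip[OF z], of "norm d"] by (simp add: mult.assoc)
      finally have "t * - (d \<bullet> (c z - c x)) \<le> t * (?b * ?s)"
        using t by (intro mult_left_mono) auto
      then have cs: "t * (d \<bullet> (c x - \<phi> *\<^sub>R \<nu>)) \<le> t * (d \<bullet> (c z - \<phi> *\<^sub>R \<nu>)) + t * ?b * ?s"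
        by (simp add: algebra_simps)
      (* completing the square absorbs the cross term t * ?b * ?s into the growth term *)
      have "0 \<le> (2 * \<kappa> * ?s - t * ?b)\<^sup>2 / (4 * \<kappa>)" using \<open>0 < \<kappa>\<close> by simp
      also have "\<dots> = \<kappa> * ?s\<^sup>2 - t * ?b * ?s + t\<^sup>2 * (?b\<^sup>2 / (4 * \<kappa>))"
        using \<open>0 < \<kappa>\<close> by (simp add: field_simps power2_eq_square)
      finally have "t * ?b * ?s \<le> \<kappa> * ?s\<^sup>2 + t\<^sup>2 * (?b\<^sup>2 / (4 * \<kappa>))" by simp
      moreover have "t\<^sup>2 * B = t\<^sup>2 * (?b\<^sup>2 / (4 * \<kappa>)) + t\<^sup>2 * (\<phi> / 2 * (norm d)\<^sup>2)"
        unfolding B_def by (rule distrib_left)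
      ultimately show "L x \<nu> + t * (d \<bullet> (c x - \<phi> *\<^sub>R \<nu>)) - t\<^sup>2 * B \<le> L z ?m"
        using growth[OF z] cs unfolding shift by linarith
    qed (use \<open>x \<in> Z\<close> in blast)
    also have "\<dots> \<le> L x \<nu>" using max[OF mN] Linf by simp
    finally have "t * (d \<bullet> (c x - \<phi> *\<^sub>R \<nu>)) \<le> t * (t * B)"
      by (simp add: power2_eq_square mult.assoc)
    then show ?thesis using t by simp
  qed
  have "((\<lambda>t. t * B) \<longlongrightarrow> 0 * B) (at_right 0)" by (intro tendsto_intros)
  moreover have "\<forall>\<^sub>F t in at_right 0. d \<bullet> (c x - \<phi> *\<^sub>R \<nu>) \<le> t * B"
    using bound by (auto intro!: exI[of _ 1] simp: eventually_at_right[of "0::real" 1])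
  ultimately show ?thesis
    unfolding d_def by (intro tendsto_lowerbound[where f = "\<lambda>t. t * B" and F = "at_right 0"]) auto
qed

section \<open>The voltage control problem\<close>

lemma convex_feasible:
  assumes "\<And>i. convex (zset S i)"
  shows "convex (feasible S)"
proof (rule convexI)
  fix z w and u v :: real
  assume zw: "z \<in> feasible S" "w \<in> feasible S" and uv: "0 \<le> u" "0 \<le> v" "u + v = 1"
  show "u *\<^sub>R z + v *\<^sub>R w \<in> feasible S"
    using convexD[OF assms _ _ uv] zw unfolding feasible_def by fastforce
qed

lemma closed_feasible:
  assumes "\<And>i. closed (zset S i)"
  shows "closed (feasible S)"
proof -
  have eq: "feasible S = (\<Inter>i. (\<lambda>z. (fst z $ i, snd z $ i)) -` zset S i)"
    by (auto simp: feasible_def)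
  show ?thesis
    unfolding eq
    by (intro closed_INT ballI closed_vimage assms continuous_intros)
qed

lemma convex_nonneg_multipliers: "convex (nonneg_multipliers :: 'n::finite multiplier set)"
  by (rule convexI) (auto simp: nonneg_multipliers_def less_eq_vec_def)

lemma closed_nonneg_multipliers: "closed (nonneg_multipliers :: 'n::finite multiplier set)"
  unfolding nonneg_multipliers_def less_eq_vec_def zero_index
  by (intro closed_Collect_conj closed_Collect_all closed_Collect_le continuous_intros)

text \<open>The measured map projects each injection and each multiplier separately, wherever its
  argument lies; so an iterate can leave the domain only because the domain changes with time.\<close>
lemma T_meas_in_domain:
  assumes "\<And>i. closed (zset S i)" "\<And>i. zset S i \<noteq> {}"
  shows "T_meas R X \<phi> \<epsilon>1 \<epsilon>2 S y \<in> domain S"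
  using closest_point_in_set[OF assms]
  by (simp add: T_meas_def Let_def domain_def feasible_def nonneg_multipliers_def pos_part_def
      less_eq_vec_def)

text \<open>The Lagrangian is a cost plus the pairing of the multiplier with an affine function of the
  injections, minus the regularisation; \<open>lagrangian_eq\<close> brings it to the form treated in
  \<open>dual_maximizer_variational_inequality\<close>.\<close>
definition constraint_gap ::
  "real^'n^'n \<Rightarrow> real^'n^'n \<Rightarrow> real^'n \<Rightarrow> 'n::finite snapshot \<Rightarrow> 'n injection \<Rightarrow> 'n multiplier" where
  "constraint_gap R X a S z = (vlow S - lin_volt R X a z, lin_volt R X a z - vhigh S)"

definition operating_cost ::
  "real^'n^'n \<Rightarrow> real^'n^'n \<Rightarrow> real^'n \<Rightarrow> 'n::finite snapshot \<Rightarrow> 'n injection \<Rightarrow> real" where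
  "operating_cost R X a S z =
     (\<Sum>i\<in>UNIV. cost S i (fst z $ i, snd z $ i)) + weight S * vcost S (lin_volt R X a z)"

lemma lagrangian_eq:
  "lagrangian R X a \<phi> S z \<mu> =
     operating_cost R X a S z + \<mu> \<bullet> constraint_gap R X a S z - \<phi> / 2 * (norm \<mu>)\<^sup>2"
  by (cases \<mu>) (simp add: lagrangian_def operating_cost_def constraint_gap_def)

lemma lin_volt_diff:
  "lin_volt R X a z - lin_volt R X a w = R *v fst (z - w) + X *v snd (z - w)"
  by (simp add: lin_volt_def matrix_vector_mult_diff_distrib)

lemma lin_volt_combination:
  assumes "u + v = 1"
  shows "lin_volt R X a (u *\<^sub>R z + v *\<^sub>R w) = u *\<^sub>R lin_volt R X a z + v *\<^sub>R lin_volt R X a w"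
proof -
  have "a = u *\<^sub>R a + v *\<^sub>R a" using assms by (metis scaleR_add_left scaleR_one)
  then show ?thesis
    by (simp add: lin_volt_def matrix_vector_right_distrib matrix_vector_mult_scaleR scaleR_add_right)
qed

lemma constraint_gap_combination:
  assumes "u + v = 1"
  shows "constraint_gap R X a S (u *\<^sub>R z + v *\<^sub>R w) =
    u *\<^sub>R constraint_gap R X a S z + v *\<^sub>R constraint_gap R X a S w"
proof -
  have split: "b = u *\<^sub>R b + v *\<^sub>R b" for b :: "real^'n"
    using assms by (metis scaleR_add_left scaleR_one)
  have below: "b - (u *\<^sub>R s + v *\<^sub>R t) = u *\<^sub>R (b - s) + v *\<^sub>R (b - t)"
    and above: "(u *\<^sub>R s + v *\<^sub>R t) - b = u *\<^sub>R (s - b) + v *\<^sub>R (t - b)" for b s t :: "real^'n"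
    by (subst split[of b], simp add: scaleR_diff_right)+
  show ?thesis
    by (simp only: constraint_gap_def lin_volt_combination[OF assms] below above scaleR_Pair add_Pair)
qed

lemma constraint_gap_lipschitz:
  obtains M where "\<And>z w. norm (constraint_gap R X a S z - constraint_gap R X a S w) \<le> M * norm (z - w)"
proof -
  have "bounded_linear (\<lambda>h. (- (R *v fst h + X *v snd h), R *v fst h + X *v snd h))"
    by (intro bounded_linear_Pair bounded_linear_minus bounded_linear_add
        bounded_linear_compose[OF matrix_vector_mul_bounded_linear] bounded_linear_fst bounded_linear_snd)
  then obtain M where M: "\<And>h. norm (- (R *v fst h + X *v snd h), R *v fst h + X *v snd h) \<le> norm h * M"
    using bounded_linear.bounded by blast
  have "constraint_gap R X a S z - constraint_gap R X a S w =
      (- (R *v fst (z - w) + X *v snd (z - w)), R *v fst (z - w) + X *v snd (z - w))" for z w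
    unfolding lin_volt_diff[of R X a, symmetric] by (simp add: constraint_gap_def)
  then show ?thesis using that[of M] M[of "_ - _"] by (simp add: mult.commute)
qed

lemma norm_injection_eq:
  "(norm (z :: 'n::finite injection))\<^sup>2 = (\<Sum>i\<in>UNIV. (norm (fst z $ i, snd z $ i))\<^sup>2)"
  by (cases z) (simp add: power2_norm_eq_inner inner_vec_def sum.distrib)

text \<open>The nodes are finitely many, so their strong convexity constants have a positive minimum, and
  the squared norms of the node injections add up to that of the whole injection.  The remaining
  terms are convex in the injections, as compositions with an affine map, or constant.\<close>
lemma strongly_convex_on_lagrangian:
  assumes cost: "\<And>i. strongly_convex_on (zset S i) (cost S i)"
    and "convex_on UNIV (vcost S)" "0 \<le> weight S"
  shows "strongly_convex_on (feasible S) (\<lambda>z. lagrangian R X a \<phi> S z \<mu>)"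
proof -
  obtain c where cpos: "\<And>i. c i > 0" and c: "\<And>i x y u. x \<in> zset S i \<Longrightarrow> y \<in> zset S i \<Longrightarrow> u \<in> {0..1} \<Longrightarrow>
     cost S i ((1 - u) *\<^sub>R x + u *\<^sub>R y)
       \<le> (1 - u) * cost S i x + u * cost S i y - c i / 2 * u * (1 - u) * (norm (x - y))\<^sup>2"
    using cost unfolding strongly_convex_on_def by metis
  define k where "k = Min (range c)"
  have "k > 0" using cpos by (simp add: k_def)
  have k: "k \<le> c i" for i by (simp add: k_def)
  have "lagrangian R X a \<phi> S ((1 - u) *\<^sub>R z + u *\<^sub>R w) \<mu>
      \<le> (1 - u) * lagrangian R X a \<phi> S z \<mu> + u * lagrangian R X a \<phi> S w \<mu>
        - k / 2 * u * (1 - u) * (norm (z - w))\<^sup>2"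
    if zw: "z \<in> feasible S" "w \<in> feasible S" and u: "u \<in> {0..1}" for z w u
  proof -
    let ?at = "\<lambda>z i. (fst z $ i, snd z $ i)"
    have "cost S i (?at ((1 - u) *\<^sub>R z + u *\<^sub>R w) i)
        \<le> (1 - u) * cost S i (?at z i) + u * cost S i (?at w i)
          - k / 2 * u * (1 - u) * (norm (?at (z - w) i))\<^sup>2" for i
    proof -
      have "cost S i ((1 - u) *\<^sub>R ?at z i + u *\<^sub>R ?at w i)
         \<le> (1 - u) * cost S i (?at z i) + u * cost S i (?at w i)
          - c i / 2 * u * (1 - u) * (norm (?at z i - ?at w i))\<^sup>2"
        using zw u by (intro c) (auto simp: feasible_def)
      moreover have "k / 2 * u * (1 - u) * (norm (?at z i - ?at w i))\<^sup>2
         \<le> c i / 2 * u * (1 - u) * (norm (?at z i - ?at w i))\<^sup>2"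
        using k[of i] u by (intro mult_right_mono) auto
      ultimately show ?thesis by simp
    qed
    then have "(\<Sum>i\<in>UNIV. cost S i (?at ((1 - u) *\<^sub>R z + u *\<^sub>R w) i))
        \<le> (\<Sum>i\<in>UNIV. (1 - u) * cost S i (?at z i) + u * cost S i (?at w i)
          - k / 2 * u * (1 - u) * (norm (?at (z - w) i))\<^sup>2)"
      by (rule sum_mono)
    also have "\<dots> = (1 - u) * (\<Sum>i\<in>UNIV. cost S i (?at z i)) + u * (\<Sum>i\<in>UNIV. cost S i (?at w i))
          - k / 2 * u * (1 - u) * (norm (z - w))\<^sup>2"
      by (simp only: sum.distrib sum_subtractf sum_distrib_left norm_injection_eq)
    finally have 1: "(\<Sum>i\<in>UNIV. cost S i (?at ((1 - u) *\<^sub>R z + u *\<^sub>R w) i)) \<le> \<dots>" .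
    have "vcost S (lin_volt R X a ((1 - u) *\<^sub>R z + u *\<^sub>R w))
        \<le> (1 - u) * vcost S (lin_volt R X a z) + u * vcost S (lin_volt R X a w)"
      using convex_onD[OF assms(2), of u] u by (simp add: lin_volt_combination)
    then have 2: "weight S * vcost S (lin_volt R X a ((1 - u) *\<^sub>R z + u *\<^sub>R w))
        \<le> weight S * ((1 - u) * vcost S (lin_volt R X a z) + u * vcost S (lin_volt R X a w))"
      using assms(3) by (rule mult_left_mono)
    have 3: "\<mu> \<bullet> constraint_gap R X a S ((1 - u) *\<^sub>R z + u *\<^sub>R w)
        = (1 - u) * (\<mu> \<bullet> constraint_gap R X a S z) + u * (\<mu> \<bullet> constraint_gap R X a S w)"
      by (simp add: constraint_gap_combination inner_add_right)
    have combine: "A + B + ((1 - u) * g1 + u * g2) - f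
        \<le> (1 - u) * (A1 + b * d1 + g1 - f) + u * (A2 + b * d2 + g2 - f) - s"
      if "A \<le> (1 - u) * A1 + u * A2 - s" "B \<le> b * ((1 - u) * d1 + u * d2)"
      for A A1 A2 B b d1 d2 g1 g2 f s :: real
      using that by (simp add: algebra_simps)
    show ?thesis
      unfolding lagrangian_eq operating_cost_def 3 using 1 2 by (rule combine)
  qed
  then show ?thesis
    unfolding strongly_convex_on_def using \<open>k > 0\<close> by blast
qed

lemma lagrangian_differentiable_primal:
  assumes cost: "\<And>i. cost S i differentiable (at (fst z $ i, snd z $ i))"
    and vcost: "vcost S differentiable (at (lin_volt R X a z))"
  shows "(\<lambda>z. lagrangian R X a \<phi> S z \<mu>) differentiable (at z)"
proof -
  have coord: "(\<lambda>z. (fst z $ i, snd z $ i)) differentiable (at z)" for i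
    by (intro bounded_linear_imp_differentiable bounded_linear_Pair
        bounded_linear_compose[OF bounded_linear_vec_nth] bounded_linear_fst bounded_linear_snd)
  have volt: "lin_volt R X a differentiable (at z)"
    unfolding lin_volt_def
    by (intro differentiable_add differentiable_const bounded_linear_imp_differentiable
        bounded_linear_compose[OF matrix_vector_mul_bounded_linear] bounded_linear_fst bounded_linear_snd)
  show ?thesis
    unfolding lagrangian_def
    by (intro differentiable_add differentiable_diff differentiable_mult differentiable_inner
        differentiable_const volt differentiable_sum finite ballI
        differentiable_compose[of "cost S _", OF cost coord]
        differentiable_compose[of "vcost S", OF vcost volt])
qed

lemma lagrangian_gderiv_dual:
  "GDERIV (lagrangian R X a \<phi> S z) \<mu> :> constraint_gap R X a S z - \<phi> *\<^sub>R \<mu>"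
  unfolding gderiv_def lagrangian_eq power2_norm_eq_inner
  by (auto intro!: derivative_eq_intros simp: algebra_simps inner_commute)

text \<open>The minus sign on the dual gradient in the step makes it an ascent step, so the inequalities
  for the minimiser and for the maximiser add up to the single variational inequality that
  characterises the projection onto the product domain.\<close>
lemma maxmin_solution_fixed_point:
  assumes zset: "\<And>i. zset S i \<noteq> {} \<and> convex (zset S i) \<and> closed (zset S i)"
    and cost: "\<And>i. C1_on (zset S i) (cost S i)" "\<And>i. strongly_convex_on (zset S i) (cost S i)"
    and vcost: "C1_on UNIV (vcost S)" "convex_on UNIV (vcost S)" "0 \<le> weight S"
    and steps: "0 < \<epsilon>1" "0 < \<epsilon>2"
    and sol: "maxmin_solution R X a \<phi> S y"
  shows "y \<in> domain S" "T_hat R X a \<phi> \<epsilon>1 \<epsilon>2 S y = y"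
proof -
  let ?L = "lagrangian R X a \<phi> S"
  obtain x \<nu> where y: "y = (x, \<nu>)" by (cases y)
  have x: "x \<in> feasible S" and xmin: "\<And>w. w \<in> feasible S \<Longrightarrow> ?L x \<nu> \<le> ?L w \<nu>"
    and \<nu>: "\<nu> \<in> nonneg_multipliers"
    and \<nu>max: "\<And>\<mu>. \<mu> \<in> nonneg_multipliers \<Longrightarrow>
      (INF z\<in>feasible S. ?L z \<mu>) \<le> (INF z\<in>feasible S. ?L z \<nu>)"
    using sol unfolding maxmin_solution_def is_arg_max_def is_arg_min_def y by (auto simp: not_less)
  show dom: "y \<in> domain S" using x \<nu> by (simp add: domain_def y)
  have cvx: "convex (feasible S)" and cl: "closed (feasible S)"
    using zset by (auto intro: convex_feasible closed_feasible)
  define g where "g = gradient (\<lambda>z. ?L z \<nu>) x"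
  have "GDERIV (\<lambda>z. ?L z \<nu>) x :> g"
    unfolding g_def
    by (intro differentiable_imp_gderiv_gradient lagrangian_differentiable_primal)
      (use cost(1) vcost(1) x in \<open>auto simp: C1_on_def feasible_def\<close>)
  then have primal: "0 \<le> (z - x) \<bullet> g" if "z \<in> feasible S" for z
    using minimizer_variational_inequality[OF cvx x that, where f = "\<lambda>z. ?L z \<nu>"] xmin by blast
  obtain \<kappa> where \<kappa>: "0 < \<kappa>" and growth: "\<And>z. z \<in> feasible S \<Longrightarrow> ?L x \<nu> + \<kappa> * (norm (z - x))\<^sup>2 \<le> ?L z \<nu>"
    using strongly_convex_on_quadratic_growth[OF strongly_convex_on_lagrangian[OF cost(2) vcost(2,3)] cvx]
      x xmin by metis
  obtain M where M: "\<And>z w. norm (constraint_gap R X a S z - constraint_gap R X a S w) \<le> M * norm (z - w)"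
    using constraint_gap_lipschitz by blast
  define h where "h = gradient (?L x) \<nu>"
  have h: "h = constraint_gap R X a S x - \<phi> *\<^sub>R \<nu>"
    unfolding h_def by (intro gradient_eqI lagrangian_gderiv_dual)
  have dual: "(\<mu> - \<nu>) \<bullet> h \<le> 0" if "\<mu> \<in> nonneg_multipliers" for \<mu>
    unfolding h
    using growth \<nu>max unfolding lagrangian_eq
    by (intro dual_maximizer_variational_inequality[OF convex_nonneg_multipliers x \<nu> that \<kappa>, where M = M] M)
  show "T_hat R X a \<phi> \<epsilon>1 \<epsilon>2 S y = y"
    unfolding T_hat_def
  proof (rule closest_point_eqI_variational)
    show "convex (domain S)" "closed (domain S)"
      unfolding domain_def
      by (intro convex_Times closed_Times cvx cl convex_nonneg_multipliers closed_nonneg_multipliers)+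
    fix w assume "w \<in> domain S"
    then have "0 \<le> (fst w - x) \<bullet> g" "(snd w - \<nu>) \<bullet> h \<le> 0"
      using primal dual by (auto simp: domain_def)
    then have "0 \<le> \<epsilon>1 * ((fst w - x) \<bullet> g)" "\<epsilon>2 * ((snd w - \<nu>) \<bullet> h) \<le> 0"
      using steps by (auto simp: mult_le_0_iff)
    moreover have "(w - y) \<bullet> (y - (\<epsilon>1 *\<^sub>R g, - (\<epsilon>2 *\<^sub>R h)) - y)
        = - (\<epsilon>1 * ((fst w - x) \<bullet> g)) + \<epsilon>2 * ((snd w - \<nu>) \<bullet> h)"
      by (cases w) (simp add: y)
    ultimately show "(w - y) \<bullet> (y - (\<epsilon>1 *\<^sub>R gradient (\<lambda>z. ?L z (snd y)) (fst y),
        - (\<epsilon>2 *\<^sub>R gradient (?L (fst y)) (snd y))) - y) \<le> 0"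
      by (simp add: g_def h_def y)
  qed (fact dom)
qed

text \<open>Multipliers are unbounded, so the domain contains two distinct points.\<close>
lemma contraction_modulus_nonneg:
  assumes "feasible (S :: 'n::finite snapshot) \<noteq> {}"
    and "\<And>y1 y2. y1 \<in> domain S \<Longrightarrow> y2 \<in> domain S \<Longrightarrow> norm (f y1 - f y2) \<le> \<Delta> * norm (y1 - y2)"
  shows "0 \<le> (\<Delta> :: real)"
proof -
  obtain z where "z \<in> feasible S" using assms(1) by blast
  then have "(z, (0, 0)) \<in> domain S" "(z, (1, 0)) \<in> domain S"
    by (auto simp: domain_def nonneg_multipliers_def less_eq_vec_def)
  then have "0 \<le> \<Delta> * norm ((z, (0, 0)) - (z, (1, 0 :: real^'n)) :: 'n state)"
    using assms(2) norm_ge_zero order_trans by blast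
  moreover have "0 < norm ((z, (0, 0)) - (z, (1, 0 :: real^'n)) :: 'n state)"
    by (simp add: prod_eq_iff)
  ultimately show ?thesis by (simp add: zero_le_mult_iff)
qed

section \<open>Perturbed contractions\<close>

text \<open>The perturbations accumulate to the geometric sum \<open>\<rho> (1 + \<Delta> + \<dots> + \<Delta>\<^sup>K\<^sup>-\<^sup>1)\<close>.  The lemma serves
  both time scales: the \<open>K\<close> steps within an instant, and the sequence of instants.\<close>
lemma perturbed_contraction_iterates:
  fixes b :: "nat \<Rightarrow> real"
  assumes "0 \<le> \<Delta>" "\<Delta> < 1" and step: "\<And>k. k < K \<Longrightarrow> b (Suc k) \<le> \<Delta> * b k + \<rho>"
  shows "b K \<le> \<Delta> ^ K * b 0 + \<rho> * (1 - \<Delta> ^ K) / (1 - \<Delta>)"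
  using step
proof (induction K)
  case (Suc K)
  have "b (Suc K) \<le> \<Delta> * b K + \<rho>" using Suc.prems by simp
  also have "\<dots> \<le> \<Delta> * (\<Delta> ^ K * b 0 + \<rho> * (1 - \<Delta> ^ K) / (1 - \<Delta>)) + \<rho>"
    using Suc assms(1) by (intro add_right_mono mult_left_mono) auto
  also have "\<dots> = \<Delta> ^ Suc K * b 0 + \<rho> * (1 - \<Delta> ^ Suc K) / (1 - \<Delta>)"
    using assms(2) by (simp add: field_simps)
  finally show ?case .
qed simp

lemma limsup_affine_recursion:
  fixes b :: "nat \<Rightarrow> real"
  assumes "0 \<le> q" "q < 1" and step: "\<And>m. b (Suc m) \<le> q * b m + c"
  shows "limsup (\<lambda>m. ereal (b m)) \<le> ereal (c / (1 - q))"
proof -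
  have bound: "b m \<le> q ^ m * b 0 + c * (1 - q ^ m) / (1 - q)" for m
    using assms by (intro perturbed_contraction_iterates) auto
  have "(\<lambda>m. q ^ m * b 0 + c * (1 - q ^ m) / (1 - q)) \<longlonglongrightarrow> 0 * b 0 + c * (1 - 0) / (1 - q)"
    using assms by (intro tendsto_intros LIMSEQ_realpow_zero) auto
  then have "(\<lambda>m. ereal (q ^ m * b 0 + c * (1 - q ^ m) / (1 - q))) \<longlonglongrightarrow> ereal (c / (1 - q))"
    by simp
  then have "limsup (\<lambda>m. ereal (q ^ m * b 0 + c * (1 - q ^ m) / (1 - q))) = ereal (c / (1 - q))"
    by (intro lim_imp_Limsup) auto
  moreover have "limsup (\<lambda>m. ereal (b m)) \<le> limsup (\<lambda>m. ereal (q ^ m * b 0 + c * (1 - q ^ m) / (1 - q)))"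
    using bound by (intro Limsup_mono) auto
  ultimately show ?thesis by simp
qed

section \<open>Tracking error of the online algorithm\<close>

theorem theorem5:
  fixes S :: "nat \<Rightarrow> 'n::finite snapshot"
    and E :: "('n option \<times> 'n option) set"
    and r x :: "'n option \<times> 'n option \<Rightarrow> real"
    and R X H :: "real^'n^'n"
    and a v' :: "real^'n"
    and \<phi> \<epsilon>1 \<epsilon>2 e \<Delta> \<sigma> :: real
    and \<rho> :: "((real^'n) \<times> (real^'n)) \<times> ((real^'n) \<times> (real^'n))"
    and y_hat :: "nat \<Rightarrow> 'n state"
    and y :: "nat \<Rightarrow> nat \<Rightarrow> 'n state"
    and K \<tau> :: nat
  assumes R: "\<forall>i j. 0 < R $ i $ j" "transpose R = R"
    and X: "\<forall>i j. 0 < X $ i $ j" "transpose X = X"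
    and weight: "\<forall>m. 0 \<le> weight (S m)"
    and zset: "\<forall>m i. zset (S m) i \<noteq> {} \<and> convex (zset (S m) i) \<and> compact (zset (S m) i)"
    and tree: "distribution_tree E"
    and volt: "\<forall>m. \<forall>z\<in>feasible (S m). power_flow E r x (slack (S m)) z (volt (S m) z)"
    and A1: "\<forall>m i. C1_on (zset (S m) i) (cost (S m) i) \<and>
               strongly_convex_on (zset (S m) i) (cost (S m) i) \<and>
               bounded (gradient (cost (S m) i) ` zset (S m) i)"
    and A2: "\<forall>m. C1_on UNIV (vcost (S m)) \<and> convex_on UNIV (vcost (S m)) \<and>
               bounded (gradient (vcost (S m)) ` volt (S m) ` feasible (S m))"
    and A3: "\<forall>m. \<exists>z\<in>feasible (S m). vlow (S m) \<le> lin_volt R X a z \<and> lin_volt R X a z \<le> vhigh (S m)"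
    and A4: "0 < e" "\<forall>m i. \<forall>z\<in>feasible (S m). \<bar>volt (S m) z $ i - lin_volt R X a z $ i\<bar> \<le> e"
    and params: "0 < \<phi>" "0 < \<epsilon>1" "0 < \<epsilon>2"
    and y_hat: "\<forall>m. maxmin_solution R X a \<phi> (S m) (y_hat m)"
    and contraction: "\<Delta> < 1"
      "\<forall>m. \<forall>y1\<in>domain (S m). \<forall>y2\<in>domain (S m).
         norm (T_hat R X a \<phi> \<epsilon>1 \<epsilon>2 (S m) y1 - T_hat R X a \<phi> \<epsilon>1 \<epsilon>2 (S m) y2) \<le> \<Delta> * norm (y1 - y2)"
    and intermediate: "\<exists>z\<in>feasible (S \<tau>). \<forall>i.
         v' $ i \<in> closed_segment (lin_volt R X a z $ i) (volt (S \<tau>) z $ i)"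
    and hessian: "(gradient (vcost (S \<tau>)) has_derivative (\<lambda>h. H *v h)) (at v')"
    and \<rho>: "\<rho> = model_error R X \<epsilon>1 \<epsilon>2 e (weight (S \<tau>)) H"
      "0 \<le> fst (fst \<rho>)" "0 \<le> snd (fst \<rho>)" "0 \<le> fst (snd \<rho>)" "0 \<le> snd (snd \<rho>)"
    and gap: "\<forall>m. \<forall>y1\<in>domain (S m).
         norm (T_hat R X a \<phi> \<epsilon>1 \<epsilon>2 (S m) y1 - T_meas R X \<phi> \<epsilon>1 \<epsilon>2 (S m) y1) \<le> norm \<rho>"
    and drift: "0 < \<sigma>" "\<forall>m. norm (y_hat (Suc m) - y_hat m) \<le> \<sigma>"
    and K: "1 \<le> K"
    and y: "online_iterates R X \<phi> \<epsilon>1 \<epsilon>2 S K y"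
    and handover: "\<forall>m. y m 0 \<notin> domain (S m) \<longrightarrow>
         (\<forall>y2\<in>domain (S m).
            norm (T_hat R X a \<phi> \<epsilon>1 \<epsilon>2 (S m) (y m 0) - T_hat R X a \<phi> \<epsilon>1 \<epsilon>2 (S m) y2)
              \<le> \<Delta> * norm (y m 0 - y2)) \<and>
         norm (T_hat R X a \<phi> \<epsilon>1 \<epsilon>2 (S m) (y m 0) - T_meas R X \<phi> \<epsilon>1 \<epsilon>2 (S m) (y m 0)) \<le> norm \<rho>"
  shows "limsup (\<lambda>m. ereal (norm (y m K - y_hat m)))
           \<le> ereal (norm \<rho> / (1 - \<Delta>) + \<sigma> * \<Delta> ^ K / (1 - \<Delta> ^ K))"
proof -
  let ?T = "\<lambda>m. T_hat R X a \<phi> \<epsilon>1 \<epsilon>2 (S m)" and ?Tv = "\<lambda>m. T_meas R X \<phi> \<epsilon>1 \<epsilon>2 (S m)"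
  have zset': "zset (S m) i \<noteq> {} \<and> convex (zset (S m) i) \<and> closed (zset (S m) i)" for m i
    using zset compact_imp_closed by blast
  have yhat_dom: "y_hat m \<in> domain (S m)" and yhat_fix: "?T m (y_hat m) = y_hat m" for m
    using maxmin_solution_fixed_point[of "S m", OF zset' _ _ _ _ _ params(2,3)] A1 A2 weight y_hat
    by blast+
  have \<Delta>0: "0 \<le> \<Delta>"
    using contraction_modulus_nonneg[of "S 0" "?T 0"] A3 contraction(2) by blast
  have iter: "y m (Suc k) = ?Tv m (y m k)" if "k < K" for m k
    using y that by (simp add: online_iterates_def)
  have inner_step: "norm (y m (Suc k) - y_hat m) \<le> \<Delta> * norm (y m k - y_hat m) + norm \<rho>"
    if k: "k < K" for m k
  proof -
    have "norm (?T m (y m k) - ?T m (y_hat m)) \<le> \<Delta> * norm (y m k - y_hat m) \<and>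
        norm (?T m (y m k) - ?Tv m (y m k)) \<le> norm \<rho>"
    proof (cases "y m k \<in> domain (S m)")
      case True
      then show ?thesis using contraction(2) gap yhat_dom by blast
    next
      case False
      (* every later iterate is a value of the measured map of the same instant *)
      have "k = 0"
      proof (rule ccontr)
        assume "k \<noteq> 0"
        then obtain l where "k = Suc l" using not0_implies_Suc by blast
        then have "y m k = ?Tv m (y m l)" using iter k by simp
        then show False using False T_meas_in_domain zset' by metis
      qed
      then show ?thesis using handover False yhat_dom by blast
    qed
    moreover have "y m (Suc k) - y_hat m =
        (?T m (y m k) - ?T m (y_hat m)) - (?T m (y m k) - ?Tv m (y m k))"
      using iter[OF k] yhat_fix by simp
    then have "norm (y m (Suc k) - y_hat m)
        \<le> norm (?T m (y m k) - ?T m (y_hat m)) + norm (?T m (y m k) - ?Tv m (y m k))"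
      using norm_triangle_ineq4 by metis
    ultimately show ?thesis by linarith
  qed
  define q c where "q = \<Delta> ^ K" and "c = q * \<sigma> + norm \<rho> * (1 - q) / (1 - \<Delta>)"
  have q: "0 \<le> q" "q < 1"
    using \<Delta>0 contraction(1) K by (auto simp: q_def power_less_one_iff)
  have outer_step: "norm (y (Suc m) K - y_hat (Suc m)) \<le> q * norm (y m K - y_hat m) + c" for m
  proof -
    have "y (Suc m) 0 - y_hat (Suc m) = (y m K - y_hat m) - (y_hat (Suc m) - y_hat m)"
      using y by (simp add: online_iterates_def)
    then have "norm (y (Suc m) 0 - y_hat (Suc m)) \<le> norm (y m K - y_hat m) + norm (y_hat (Suc m) - y_hat m)"
      using norm_triangle_ineq4 by metis
    also have "\<dots> \<le> norm (y m K - y_hat m) + \<sigma>" using drift(2) by simp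
    finally have start: "norm (y (Suc m) 0 - y_hat (Suc m)) \<le> norm (y m K - y_hat m) + \<sigma>" .
    have "norm (y (Suc m) K - y_hat (Suc m))
        \<le> q * norm (y (Suc m) 0 - y_hat (Suc m)) + norm \<rho> * (1 - q) / (1 - \<Delta>)"
      unfolding q_def
      using perturbed_contraction_iterates[OF \<Delta>0 contraction(1),
          of K "\<lambda>k. norm (y (Suc m) k - y_hat (Suc m))"] inner_step by blast
    also have "\<dots> \<le> q * (norm (y m K - y_hat m) + \<sigma>) + norm \<rho> * (1 - q) / (1 - \<Delta>)"
      using start q(1) by (intro add_right_mono mult_left_mono)
    finally show ?thesis by (simp add: c_def distrib_left)
  qed
  have "c / (1 - q) = norm \<rho> / (1 - \<Delta>) + \<sigma> * \<Delta> ^ K / (1 - \<Delta> ^ K)"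
    using q contraction(1) by (simp add: c_def q_def add_divide_distrib)
  then show ?thesis
    using limsup_affine_recursion[where b = "\<lambda>m. norm (y m K - y_hat m)", OF q outer_step] by simp
qed

end
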